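(* Let $a\in\mathbb{R}$, $n\in\mathbb{Z}_+$, $\alpha\in(0,1)$, and let $w:\mathbb{N}_a\to\mathbb{R}\setminus\{0\}$ satisfy $\frac{w(a)}{w(k)}>0$ for all $k\in\mathbb{N}_{a+1}$. Let $W:\mathbb{R}^n\to\mathbb{R}$ be convex with $W(0)=0$. Let $x:\mathbb{N}_a\to\mathbb{R}^n$, put $z(k):=w(k)x(k)$ and $V(x(k)):=w^{-1}(k)W(w(k)x(k))$. Let $\zeta(z(k))\in\partial W(z(k))$ and $\zeta(x(k))\in\partial V(x(k))$ be subgradients such that $\zeta(z(k))=\zeta(x(k))$ for all $k$. Then for all $k\in\mathbb{N}_{a+1}$, $${}_a^{\rm C}\nabla_k^{\alpha,w(k)}V(x(k))\le \zeta^{\rm T}(x(k))\,{}_a^{\rm C}\nabla_k^{\alpha,w(k)}x(k),$$ $${}_a^{\rm R}\nabla_k^{\alpha,w(k)}V(x(k))\le \zeta^{\rm T}(x(k))\,{}_a^{\rm R}\nabla_k^{\alpha,w(k)}x(k),$$ $${}_a^{\rm G}\nabla_k^{\alpha,w(k)}V(x(k))\le \zeta^{\rm T}(x(k))\,{}_a^{\rm G}\nabla_k^{\alpha,w(k)}x(k).$$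
   Context: For $a\in\mathbb{R}$, $\mathbb{N}_a:=\{a,a+1,a+2,\dots\}$. The nabla difference is $\nabla x(k):=x(k)-x(k-1)$. For $\beta\in(-1,1)$, the Grünwald–Letnikov difference/sum is $${}_a^{\rm G}\nabla_k^{\beta}x(k):=\sum_{i=0}^{k-a-1}(-1)^i\binom{\beta}{i}x(k-i),\qquad \binom{p}{q}:=\frac{\Gamma(p+1)}{\Gamma(q+1)\Gamma(p-q+1)},$$ with the empty sum (at $k=a$) equal to $0$. For $\alpha\in(0,1)$ and $k\in\mathbb{N}_{a+1}$, ${}_a^{\rm R}\nabla_k^{\alpha}x(k):=\nabla\,{}_a^{\rm G}\nabla_k^{\alpha-1}x(k)$ (Riemann–Liouville) and ${}_a^{\rm C}\nabla_k^{\alpha}x(k):={}_a^{\rm G}\nabla_k^{\alpha-1}\nabla x(k)$ (Caputo). Given a tempered function $w$, for each ${\rm X}\in\{{\rm G},{\rm R},{\rm C}\}$ the tempered operator is ${}_a^{\rm X}\nabla_k^{\alpha,w(k)}x(k):=w^{-1}(k)\,{}_a^{\rm X}\nabla_k^{\alpha}[w(k)x(k)]$, where $w^{-1}(k)=1/w(k)$; on vector-valued sequences all operators act componentwise. $V(x(k))$ denotes the sequence $k\mapsto w^{-1}(k)W(w(k)x(k))$. $\partial W(z(k))$ is the subdifferential of $W$ at $z(k)$, and $\partial V(x(k))$ is the subdifferential at $\xi=x(k)$ of $\xi\mapsto w^{-1}(k)W(w(k)\xi)$ with $k$ held fixed; here $\zeta\in\partial F(\xi_0)$ means $F(\xi)\ge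 F(\xi_0)+\zeta^{\rm T}(\xi-\xi_0)$ for all $\xi\in\mathbb{R}^n$. *)

theory Defs
  imports "HOL-Analysis.Analysis"
begin

text \<open>
  A sequence on \<open>{a, a + 1, a + 2, \<dots>}\<close> is a function on \<^typ>\<open>real\<close>; its values off this set
  are irrelevant. Vector-valued sequences live in a real vector space, so that on \<open>real ^ 'n\<close> the
  operators act componentwise (lemmas \<open>nabla_component\<close>, \<open>GL_component\<close>, \<open>RL_component\<close>,
  \<open>Cap_component\<close>, \<open>tempered_component\<close>).
\<close>

definition nat_from :: "real \<Rightarrow> real set"
  where "nat_from a = {a + real m | m. True}"

text \<open>
  In the Gamma quotient, \<^const>\<open>Gamma\<close> is 0 at its poles and division by 0 gives 0. So a pole in the
  denominator yields 0, as in the convention \<open>1 / Gamma = 0\<close> there.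
\<close>

definition gamma_binomial :: "real \<Rightarrow> real \<Rightarrow> real"
  where "gamma_binomial p q = Gamma (p + 1) / (Gamma (q + 1) * Gamma (p - q + 1))"

lemma gamma_binomial_eq_gchoose:
  assumes "p > -1"
  shows "gamma_binomial p (real i) = p gchoose i"
proof -
  have "p + 1 \<notin> \<int>\<^sub>\<le>\<^sub>0"
    using assms by (auto elim!: nonpos_Ints_cases)
  then show ?thesis
    by (simp add: gamma_binomial_def gbinomial_Gamma Gamma_fact add.commute)
qed

definition nabla :: "(real \<Rightarrow> 'v::real_vector) \<Rightarrow> real \<Rightarrow> 'v"
  where "nabla x k = x k - x (k - 1)"

text \<open>
  For \<open>k = a + m\<close> the index set is \<open>{0, \<dots>, m - 1}\<close>, empty at \<open>k = a\<close>.
\<close>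

definition GL :: "real \<Rightarrow> real \<Rightarrow> (real \<Rightarrow> 'v::real_vector) \<Rightarrow> real \<Rightarrow> 'v"
  where "GL a \<beta> x k =
    (\<Sum>i | real i \<le> k - a - 1. ((-1) ^ i * gamma_binomial \<beta> (real i)) *\<^sub>R x (k - real i))"

lemma GL_shift:
  "GL a \<beta> x (a + real m) =
    (\<Sum>i<m. ((-1) ^ i * gamma_binomial \<beta> (real i)) *\<^sub>R x (a + real m - real i))"
proof -
  have "{i. real i \<le> a + real m - a - 1} = {..<m}"
    by auto
  then show ?thesis
    by (simp add: GL_def)
qed

definition RL :: "real \<Rightarrow> real \<Rightarrow> (real \<Rightarrow> 'v::real_vector) \<Rightarrow> real \<Rightarrow> 'v"
  where "RL a \<alpha> x = nabla (GL a (\<alpha> - 1) x)"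

definition Cap :: "real \<Rightarrow> real \<Rightarrow> (real \<Rightarrow> 'v::real_vector) \<Rightarrow> real \<Rightarrow> 'v"
  where "Cap a \<alpha> x = GL a (\<alpha> - 1) (nabla x)"

definition tempered ::
  "((real \<Rightarrow> 'v::real_vector) \<Rightarrow> real \<Rightarrow> 'v) \<Rightarrow> (real \<Rightarrow> real) \<Rightarrow> (real \<Rightarrow> 'v) \<Rightarrow> real \<Rightarrow> 'v"
  where "tempered D w x k = inverse (w k) *\<^sub>R D (\<lambda>j. w j *\<^sub>R x j) k"

lemma nabla_component: "nabla x k $ i = nabla (\<lambda>j. x j $ i) k"
  for x :: "real \<Rightarrow> real ^ 'n"
  by (simp add: nabla_def)

lemma GL_component: "GL a \<beta> x k $ i = GL a \<beta> (\<lambda>j. x j $ i) k"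
  for x :: "real \<Rightarrow> real ^ 'n"
  by (simp add: GL_def)

lemma RL_component: "RL a \<alpha> x k $ i = RL a \<alpha> (\<lambda>j. x j $ i) k"
  for x :: "real \<Rightarrow> real ^ 'n"
  by (simp add: RL_def nabla_component GL_component)

lemma Cap_component: "Cap a \<alpha> x k $ i = Cap a \<alpha> (\<lambda>j. x j $ i) k"
  for x :: "real \<Rightarrow> real ^ 'n"
  by (simp add: Cap_def nabla_component GL_component)

lemma tempered_component:
  fixes x :: "real \<Rightarrow> real ^ 'n"
  assumes "\<And>y. D y k $ i = D' (\<lambda>j. y j $ i) k"
  shows "tempered D w x k $ i = tempered D' w (\<lambda>j. x j $ i) k"
  by (simp add: tempered_def assms)

definition subdifferential :: "('v::real_inner \<Rightarrow> real) \<Rightarrow> 'v \<Rightarrow> 'v set"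
  where "subdifferential F \<xi>0 = {\<zeta>. \<forall>\<xi>. F \<xi> \<ge> F \<xi>0 + \<zeta> \<bullet> (\<xi> - \<xi>0)}"

definition temper_fun :: "(real \<Rightarrow> real) \<Rightarrow> ('v::real_vector \<Rightarrow> real) \<Rightarrow> real \<Rightarrow> 'v \<Rightarrow> real"
  where "temper_fun w W k \<xi> = inverse (w k) * W (w k *\<^sub>R \<xi>)"

end

theory Submission
  imports Defs
begin

text \<open>
  Fix \<open>k\<close>, write \<open>\<zeta>\<close> for the subgradient at \<open>k\<close>, and consider the gap
  \<open>e j = W (z j) - \<zeta> \<bullet> z j\<close>. Because each operator is linear, each claim says that
  \<open>inverse (w k)\<close> times the operator applied to \<open>e\<close> is at most 0 at \<open>k\<close>.

  If \<open>w k > 0\<close>, the subgradient inequality for \<open>W\<close> at \<open>z k\<close> says that \<open>e\<close> is minimal at \<open>k\<close>, and its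
  instance at the origin, where \<open>W\<close> vanishes, says \<open>e k \<le> 0\<close>. Write \<open>c\<^sub>i\<close> and \<open>b\<^sub>i\<close> for the signed
  binomial weights of orders \<open>\<alpha>\<close> and \<open>\<alpha> - 1\<close>. Pascal's rule gives \<open>c\<^sub>i = b\<^sub>i - b\<^sub>i\<^sub>-\<^sub>1\<close> for \<open>i \<ge> 1\<close>, so summation
  by parts turns all three operators at \<open>k = a + m + 1\<close> into the same sum \<open>\<Sum>i\<le>m. c\<^sub>i e (k - i)\<close>,
  except that the Caputo operator carries the extra term \<open>- b\<^sub>m e a\<close> (lemmas \<open>RL_eq_GL\<close> and
  \<open>Cap_eq_GL\<close>). Here \<open>c\<^sub>0 = 1\<close>, the later \<open>c\<^sub>i\<close> are nonpositive, all \<open>b\<^sub>i\<close> are nonnegative, and the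
  \<open>c\<^sub>i\<close> up to \<open>m\<close> add up to \<open>b\<^sub>m\<close>. Replacing every value of \<open>e\<close> by its minimum \<open>e k\<close> therefore only
  increases the expression, to \<open>b\<^sub>m e k \<le> 0\<close> in the first two cases and to \<open>0\<close> in the Caputo case.

  If \<open>w k < 0\<close>, multiplying by \<open>w k\<close> reverses the subgradient inequality of the tempered function
  and turns it into an affine upper bound for \<open>W\<close> with slope \<open>\<zeta>\<close>. Together with the same affine
  lower bound, from the subgradient inequality of \<open>W\<close> itself, and \<open>W 0 = 0\<close>, this forces \<open>W \<eta> = \<zeta> \<bullet> \<eta>\<close> everywhere, so \<open>e\<close> vanishes and all claims are equalities.
\<close>

section \<open>Signed binomial weights\<close>

definition gl_weight :: "real \<Rightarrow> nat \<Rightarrow> real"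
  where "gl_weight \<beta> i = (-1) ^ i * (\<beta> gchoose i)"

lemma gl_weight_0 [simp]: "gl_weight \<beta> 0 = 1"
  by (simp add: gl_weight_def)

text \<open>Signs become visible once the weight is a rising factorial starting at \<open>- \<beta>\<close>.\<close>

lemma gl_weight_pochhammer: "gl_weight \<beta> i = pochhammer (- \<beta>) i / fact i"
  by (simp add: gl_weight_def gbinomial_pochhammer flip: power_mult_distrib mult.assoc)

lemma gl_weight_nonneg:
  assumes "\<beta> < 0"
  shows "gl_weight \<beta> i \<ge> 0"
  using assms by (simp add: gl_weight_pochhammer pochhammer_nonneg)

text \<open>The leading factor \<open>- \<alpha>\<close> of the rising factorial is the only one that can be negative.\<close>

lemma gl_weight_Suc_nonpos:
  assumes "0 \<le> \<alpha>" and "\<alpha> < 1"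
  shows "gl_weight \<alpha> (Suc i) \<le> 0"
proof -
  have "pochhammer (1 - \<alpha>) i \<ge> 0"
    using assms by (simp add: pochhammer_nonneg)
  then have "\<alpha> * pochhammer (1 - \<alpha>) i \<ge> 0"
    using assms by simp
  then show ?thesis
    by (simp add: gl_weight_pochhammer pochhammer_rec divide_nonpos_pos)
qed

lemma gl_weight_pascal:
  "gl_weight \<alpha> (Suc i) = gl_weight (\<alpha> - 1) (Suc i) - gl_weight (\<alpha> - 1) i"
  using gbinomial_Suc_Suc[of "\<alpha> - 1" i] by (simp add: gl_weight_def algebra_simps)

lemma sum_gl_weight: "(\<Sum>i<Suc m. gl_weight \<alpha> i) = gl_weight (\<alpha> - 1) m"
  by (induction m) (simp_all add: gl_weight_pascal[of \<alpha>])

text \<open>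
  Abel summation: moving the difference from the sequence onto the weights of order \<open>\<alpha> - 1\<close> produces
  the weights of order \<open>\<alpha>\<close>.
\<close>

lemma gl_weight_summation_by_parts:
  fixes g :: "nat \<Rightarrow> 'v::real_vector"
  shows "(\<Sum>i<Suc m. gl_weight (\<alpha> - 1) i *\<^sub>R (g i - g (Suc i))) =
    (\<Sum>i<Suc m. gl_weight \<alpha> i *\<^sub>R g i) - gl_weight (\<alpha> - 1) m *\<^sub>R g (Suc m)"
proof (induction m)
  case 0
  show ?case by simp
next
  case (Suc m)
  show ?case
    unfolding sum.lessThan_Suc[of _ "Suc m"] Suc.IH
    by (simp add: gl_weight_pascal[of \<alpha>] algebra_simps del: sum.lessThan_Suc)
qed

text \<open>
  The discrete maximum-principle estimate behind all three inequalities: the weights beyond the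
  first are nonpositive, so a sequence that is smallest at index 0 may be replaced by the constant
  \<open>g 0\<close>.
\<close>

lemma sum_gl_weight_le:
  fixes g :: "nat \<Rightarrow> real"
  assumes "0 \<le> \<alpha>" and "\<alpha> < 1" and min: "\<And>i. i \<le> m \<Longrightarrow> g 0 \<le> g i"
  shows "(\<Sum>i<Suc m. gl_weight \<alpha> i * g i) \<le> gl_weight (\<alpha> - 1) m * g 0"
proof -
  have "gl_weight \<alpha> i * g i \<le> gl_weight \<alpha> i * g 0" if "i < Suc m" for i
  proof (cases i)
    case (Suc j)
    with gl_weight_Suc_nonpos[OF assms(1,2)] have "gl_weight \<alpha> i \<le> 0" by simp
    with min[of i] that show ?thesis by (intro mult_left_mono_neg) simp_all
  qed simp
  then have "(\<Sum>i<Suc m. gl_weight \<alpha> i * g i) \<le> (\<Sum>i<Suc m. gl_weight \<alpha> i * g 0)"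
    by (intro sum_mono) simp
  also have "\<dots> = gl_weight (\<alpha> - 1) m * g 0"
    by (simp only: sum_gl_weight flip: sum_distrib_right)
  finally show ?thesis .
qed

section \<open>The three operators as weighted sums\<close>

lemma GL_eq_sum:
  assumes "\<beta> > -1"
  shows "GL a \<beta> x (a + real m) = (\<Sum>i<m. gl_weight \<beta> i *\<^sub>R x (a + real m - real i))"
  using assms by (simp add: GL_shift gl_weight_def gamma_binomial_eq_gchoose)

lemma Cap_eq_GL:
  assumes "\<alpha> > 0"
  shows "Cap a \<alpha> x (a + real (Suc m)) =
    GL a \<alpha> x (a + real (Suc m)) - gl_weight (\<alpha> - 1) m *\<^sub>R x a"
proof -
  define g where "g i = x (a + real (Suc m) - real i)" for i
  have "Cap a \<alpha> x (a + real (Suc m)) =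
      (\<Sum>i<Suc m. gl_weight (\<alpha> - 1) i *\<^sub>R (g i - g (Suc i)))"
    unfolding Cap_def using assms
    by (subst GL_eq_sum) (simp_all add: nabla_def g_def algebra_simps del: sum.lessThan_Suc)
  also have "\<dots> = (\<Sum>i<Suc m. gl_weight \<alpha> i *\<^sub>R g i) - gl_weight (\<alpha> - 1) m *\<^sub>R g (Suc m)"
    by (rule gl_weight_summation_by_parts)
  also have "(\<Sum>i<Suc m. gl_weight \<alpha> i *\<^sub>R g i) = GL a \<alpha> x (a + real (Suc m))"
    using assms by (subst GL_eq_sum) (simp_all add: g_def)
  finally show ?thesis by (simp add: g_def)
qed

text \<open>
  The sums at \<open>k\<close> and \<open>k - 1\<close> differ in length by one; the unpaired last term cancels the boundary
  term of the summation by parts.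
\<close>

lemma RL_eq_GL:
  assumes "\<alpha> > 0"
  shows "RL a \<alpha> x (a + real (Suc m)) = GL a \<alpha> x (a + real (Suc m))"
proof -
  define g where "g i = x (a + real (Suc m) - real i)" for i
  have "RL a \<alpha> x (a + real (Suc m)) =
      GL a (\<alpha> - 1) x (a + real (Suc m)) - GL a (\<alpha> - 1) x (a + real m)"
    by (simp add: RL_def nabla_def)
  also have "\<dots> =
      (\<Sum>i<Suc m. gl_weight (\<alpha> - 1) i *\<^sub>R g i) - (\<Sum>i<m. gl_weight (\<alpha> - 1) i *\<^sub>R g (Suc i))"
    using assms
    by (subst (1 2) GL_eq_sum) (simp_all add: g_def algebra_simps del: sum.lessThan_Suc)
  also have "\<dots> = (\<Sum>i<Suc m. gl_weight (\<alpha> - 1) i *\<^sub>R (g i - g (Suc i)))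
      + gl_weight (\<alpha> - 1) m *\<^sub>R g (Suc m)"
    by (simp add: scaleR_diff_right sum_subtractf)
  also have "\<dots> = (\<Sum>i<Suc m. gl_weight \<alpha> i *\<^sub>R g i)"
    by (simp only: gl_weight_summation_by_parts) simp
  also have "\<dots> = GL a \<alpha> x (a + real (Suc m))"
    using assms by (subst GL_eq_sum) (simp_all add: g_def)
  finally show ?thesis .
qed

section \<open>Sequences that are minimal at the evaluation point\<close>

lemma GL_nonpos_at_min:
  fixes e :: "real \<Rightarrow> real"
  assumes "0 < \<alpha>" and "\<alpha> < 1" and k: "k = a + real (Suc m)"
    and min: "\<And>j. j \<in> nat_from a \<Longrightarrow> e k \<le> e j" and "e k \<le> 0"
  shows "GL a \<alpha> e k \<le> 0"
proof -
  have "e (k - real 0) \<le> e (k - real i)" if "i \<le> m" for i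
    using that min[of "k - real i"] unfolding k nat_from_def
    by (force intro: exI[of _ "Suc m - i"] simp: of_nat_diff)
  then have "GL a \<alpha> e k \<le> gl_weight (\<alpha> - 1) m * e k"
    using sum_gl_weight_le[of \<alpha> m "\<lambda>i. e (k - real i)"] assms(1,2)
    by (simp add: k GL_eq_sum del: sum.lessThan_Suc of_nat_Suc)
  also have "\<dots> \<le> 0"
    using assms by (intro mult_nonneg_nonpos gl_weight_nonneg) auto
  finally show ?thesis .
qed

text \<open>
  The Caputo operator annihilates constants, so only the differences \<open>e j - e k\<close> matter. They are
  nonnegative and vanish at \<open>k\<close>, so the previous estimate applies to them.
\<close>

lemma Cap_nonpos_at_min:
  fixes e :: "real \<Rightarrow> real"
  assumes "0 < \<alpha>" and "\<alpha> < 1" and k: "k = a + real (Suc m)"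
    and min: "\<And>j. j \<in> nat_from a \<Longrightarrow> e k \<le> e j"
  shows "Cap a \<alpha> e k \<le> 0"
proof -
  let ?d = "\<lambda>j. e j - e k"
  have "a \<in> nat_from a"
    unfolding nat_from_def by (auto intro: exI[of _ 0])
  then have "gl_weight (\<alpha> - 1) m * ?d a \<ge> 0"
    using assms(2) min by (intro mult_nonneg_nonneg gl_weight_nonneg) auto
  moreover have "GL a \<alpha> ?d k \<le> 0"
    using assms by (intro GL_nonpos_at_min) auto
  ultimately have "Cap a \<alpha> ?d k \<le> 0"
    using Cap_eq_GL[of \<alpha> a ?d m] assms(1) by (simp add: k)
  moreover have "Cap a \<alpha> ?d k = Cap a \<alpha> e k"
    by (simp add: Cap_def nabla_def[abs_def])
  ultimately show ?thesis by simp
qed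

section \<open>Linearity and the gap sequence\<close>

lemma GL_diff_inner:
  fixes y :: "real \<Rightarrow> 'v::real_inner"
  shows "GL a \<beta> (\<lambda>j. f j - \<zeta> \<bullet> y j) k = GL a \<beta> f k - \<zeta> \<bullet> GL a \<beta> y k"
  by (simp add: GL_def inner_sum_right right_diff_distrib sum_subtractf)

lemma nabla_diff_inner:
  fixes y :: "real \<Rightarrow> 'v::real_inner"
  shows "nabla (\<lambda>j. f j - \<zeta> \<bullet> y j) k = nabla f k - \<zeta> \<bullet> nabla y k"
  by (simp add: nabla_def inner_diff_right)

lemma RL_diff_inner:
  fixes y :: "real \<Rightarrow> 'v::real_inner"
  shows "RL a \<alpha> (\<lambda>j. f j - \<zeta> \<bullet> y j) k = RL a \<alpha> f k - \<zeta> \<bullet> RL a \<alpha> y k"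
  by (simp add: RL_def GL_diff_inner[abs_def] nabla_diff_inner)

lemma Cap_diff_inner:
  fixes y :: "real \<Rightarrow> 'v::real_inner"
  shows "Cap a \<alpha> (\<lambda>j. f j - \<zeta> \<bullet> y j) k = Cap a \<alpha> f k - \<zeta> \<bullet> Cap a \<alpha> y k"
  by (simp add: Cap_def GL_diff_inner nabla_diff_inner[abs_def])

text \<open>
  Where \<open>w\<close> vanishes, \<open>temper_fun\<close> is 0 by \<open>inverse 0 = 0\<close>, and \<open>W 0 = 0\<close> makes the identity hold
  there as well. So the sequences fed to the operators agree on the whole real line, not only on
  \<open>nat_from a\<close>, and one can be rewritten into the other.
\<close>

lemma scale_temper_fun:
  assumes "W 0 = 0"
  shows "w j * temper_fun w W j \<xi> = W (w j *\<^sub>R \<xi>)"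
  using assms by (cases "w j = 0") (simp_all add: temper_fun_def)

section \<open>Subgradients under negative tempering\<close>

text \<open>
  A negative \<open>w k\<close> makes the subgradient inequality of the tempered function an upper bound for
  \<open>W\<close> by the same affine function that bounds it from below; \<open>W 0 = 0\<close> removes the constant.
\<close>

lemma linear_if_subgradients_agree:
  fixes W :: "'v::real_inner \<Rightarrow> real"
  assumes neg: "w k < 0" and "W 0 = 0"
    and z: "\<zeta> \<in> subdifferential W (w k *\<^sub>R \<xi>)"
    and x: "\<zeta> \<in> subdifferential (temper_fun w W k) \<xi>"
  shows "W \<eta> = \<zeta> \<bullet> \<eta>"
proof -
  let ?z = "w k *\<^sub>R \<xi>"
  have affine: "W \<eta> = W ?z + \<zeta> \<bullet> (\<eta> - ?z)" for \<eta>
  proof (rule antisym)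
    let ?u = "inverse (w k) *\<^sub>R \<eta>"
    have "temper_fun w W k ?u \<ge> temper_fun w W k \<xi> + \<zeta> \<bullet> (?u - \<xi>)"
      using x unfolding subdifferential_def by blast
    then have "w k * temper_fun w W k ?u \<le> w k * (temper_fun w W k \<xi> + \<zeta> \<bullet> (?u - \<xi>))"
      using neg by (intro mult_left_mono_neg) auto
    then show "W \<eta> \<le> W ?z + \<zeta> \<bullet> (\<eta> - ?z)"
      using neg by (simp add: scale_temper_fun[where W = W, OF \<open>W 0 = 0\<close>] distrib_left inner_diff_right
          right_diff_distrib flip: mult.assoc)
  next
    show "W ?z + \<zeta> \<bullet> (\<eta> - ?z) \<le> W \<eta>"
      using z unfolding subdifferential_def by blast
  qed
  from affine[of 0] \<open>W 0 = 0\<close> have "W ?z = \<zeta> \<bullet> ?z" by simp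
  with affine[of \<eta>] show ?thesis by (simp add: inner_diff_right)
qed

section \<open>Subgradient inequalities for the tempered operators\<close>

theorem theorem3p7:
  fixes a \<alpha> :: real
    and w :: "real \<Rightarrow> real"
    and W :: "real ^ 'n \<Rightarrow> real"
    and x z \<zeta>z \<zeta>x :: "real \<Rightarrow> real ^ 'n"
    and V :: "real \<Rightarrow> real ^ 'n \<Rightarrow> real"
  assumes "0 < \<alpha>" and "\<alpha> < 1"
    and "\<forall>k\<in>nat_from a. w k \<noteq> 0"
    and "\<forall>k\<in>nat_from (a + 1). w a / w k > 0"
    and "convex_on UNIV W" and "W 0 = 0"
    and "z = (\<lambda>k. w k *\<^sub>R x k)"
    and "V = temper_fun w W"
    and "\<forall>k\<in>nat_from a. \<zeta>z k \<in> subdifferential W (z k)"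
    and "\<forall>k\<in>nat_from a. \<zeta>x k \<in> subdifferential (V k) (x k)"
    and "\<forall>k\<in>nat_from a. \<zeta>z k = \<zeta>x k"
  shows "\<forall>k\<in>nat_from (a + 1).
    tempered (Cap a \<alpha>) w (\<lambda>j. V j (x j)) k \<le> \<zeta>x k \<bullet> tempered (Cap a \<alpha>) w x k \<and>
    tempered (RL a \<alpha>) w (\<lambda>j. V j (x j)) k \<le> \<zeta>x k \<bullet> tempered (RL a \<alpha>) w x k \<and>
    tempered (GL a \<alpha>) w (\<lambda>j. V j (x j)) k \<le> \<zeta>x k \<bullet> tempered (GL a \<alpha>) w x k"
proof
  fix k assume kb: "k \<in> nat_from (a + 1)"
  then obtain m where k: "k = a + real (Suc m)"
    unfolding nat_from_def by auto
  then have ka: "k \<in> nat_from a"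
    unfolding nat_from_def by blast
  define \<zeta> where "\<zeta> = \<zeta>x k"
  have zsub: "\<zeta> \<in> subdifferential W (w k *\<^sub>R x k)"
    using assms(7,9,11) ka by (auto simp: \<zeta>_def)
  have xsub: "\<zeta> \<in> subdifferential (temper_fun w W k) (x k)"
    using assms(8,10) ka by (auto simp: \<zeta>_def)
  define e where "e j = W (z j) - \<zeta> \<bullet> z j" for j
  have Wz: "(\<lambda>j. w j *\<^sub>R V j (x j)) = (\<lambda>j. W (z j))"
    using assms(6,7,8) by (simp add: scale_temper_fun)
  have signs: "inverse (w k) * Cap a \<alpha> e k \<le> 0 \<and> inverse (w k) * RL a \<alpha> e k \<le> 0 \<and>
      inverse (w k) * GL a \<alpha> e k \<le> 0"
  proof (cases "w k > 0")
    case True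
    have lower: "W \<eta> \<ge> W (z k) + \<zeta> \<bullet> (\<eta> - z k)" for \<eta>
      using zsub assms(7) unfolding subdifferential_def by blast
    have "e k \<le> e j" for j
      using lower[of "z j"] by (simp add: e_def inner_diff_right)
    moreover have "e k \<le> 0"
      using lower[of 0] assms(6) by (simp add: e_def)
    ultimately have "GL a \<alpha> e k \<le> 0" "Cap a \<alpha> e k \<le> 0"
      using assms(1,2) k by (blast intro: GL_nonpos_at_min Cap_nonpos_at_min)+
    then show ?thesis
      using True assms(1) by (simp add: k RL_eq_GL mult_nonneg_nonpos del: of_nat_Suc)
  next
    case False
    with assms(3) ka have "w k < 0" by (meson linorder_neqE_linordered_idom)
    then have "e = (\<lambda>j. 0)"
      using linear_if_subgradients_agree[OF _ assms(6) zsub xsub] by (auto simp: e_def)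
    then show ?thesis
      by (simp add: Cap_def RL_def GL_def nabla_def)
  qed
  have tempered_gap: "tempered D w (\<lambda>j. V j (x j)) k - \<zeta> \<bullet> tempered D' w x k
      = inverse (w k) * (D (\<lambda>j. W (z j)) k - \<zeta> \<bullet> D' z k)"
    for D :: "(real \<Rightarrow> real) \<Rightarrow> real \<Rightarrow> real"
      and D' :: "(real \<Rightarrow> real ^ 'n) \<Rightarrow> real \<Rightarrow> real ^ 'n"
    using Wz assms(7) by (simp add: tempered_def right_diff_distrib)
  have gaps: "tempered (Cap a \<alpha>) w (\<lambda>j. V j (x j)) k - \<zeta> \<bullet> tempered (Cap a \<alpha>) w x k
        = inverse (w k) * Cap a \<alpha> e k"
    "tempered (RL a \<alpha>) w (\<lambda>j. V j (x j)) k - \<zeta> \<bullet> tempered (RL a \<alpha>) w x k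
        = inverse (w k) * RL a \<alpha> e k"
    "tempered (GL a \<alpha>) w (\<lambda>j. V j (x j)) k - \<zeta> \<bullet> tempered (GL a \<alpha>) w x k
        = inverse (w k) * GL a \<alpha> e k"
    unfolding tempered_gap e_def[abs_def] by (simp_all only: Cap_diff_inner RL_diff_inner GL_diff_inner)
  show "tempered (Cap a \<alpha>) w (\<lambda>j. V j (x j)) k \<le> \<zeta>x k \<bullet> tempered (Cap a \<alpha>) w x k \<and>
    tempered (RL a \<alpha>) w (\<lambda>j. V j (x j)) k \<le> \<zeta>x k \<bullet> tempered (RL a \<alpha>) w x k \<and>
    tempered (GL a \<alpha>) w (\<lambda>j. V j (x j)) k \<le> \<zeta>x k \<bullet> tempered (GL a \<alpha>) w x k"
    using signs gaps unfolding \<zeta>_def by linarith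
qed

end
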